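(* For every $n\ge 2$, the number $\beta_n(123)$ of permutations in $\mathfrak{S}_n$ that cyclically consecutively avoid the pattern $123$ is $$\beta_n(123)= n!\cdot\sum_{k=-\infty}^{\infty}\left(\frac{\sqrt{3}}{2\pi(k+1/3)}\right)^{n}.$$
   Context: A permutation $\pi\in\mathfrak{S}_n$ cyclically consecutively avoids $123$ if there is no index $1\le j\le n$ with $\pi_j<\pi_{j+1}<\pi_{j+2}$, where indices are taken modulo $n$. *)

theory Defs
  imports "HOL-Analysis.Analysis" "HOL-Combinatorics.Permutations"
begin

text \<open>The representative in \<open>{1..n}\<close> of the position \<open>j \<ge> 1\<close> modulo \<open>n\<close>.\<close>

definition cyc_pos :: "nat \<Rightarrow> nat \<Rightarrow> nat" where
  "cyc_pos n j = (j - 1) mod n + 1"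

definition cyc_consec_avoids_123 :: "nat \<Rightarrow> (nat \<Rightarrow> nat) \<Rightarrow> bool" where
  "cyc_consec_avoids_123 n \<pi> \<longleftrightarrow>
     \<not> (\<exists>j\<in>{1..n}. \<pi> (cyc_pos n j) < \<pi> (cyc_pos n (j + 1)) \<and>
                     \<pi> (cyc_pos n (j + 1)) < \<pi> (cyc_pos n (j + 2)))"

definition beta_123 :: "nat \<Rightarrow> nat" where
  "beta_123 n = card {\<pi>. \<pi> permutes {1..n} \<and> cyc_consec_avoids_123 n \<pi>}"

end

theory Submission
  imports Defs "HOL-Complex_Analysis.Complex_Analysis"
begin

text \<open>
  Rotating a cyclically avoiding permutation until the value \<open>1\<close> comes first shows that
  \<open>\<beta>\<^sub>n = n \<delta>\<^sub>n\<^sub>-\<^sub>1\<close>, where \<open>\<delta>\<^sub>n\<close> counts the orderings \<open>xs\<close> of an \<open>n\<close>-element set for which \<open>xs\<close>,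
  preceded by a smaller element, avoids \<open>123\<close>. Since no occurrence of \<open>123\<close> ends at, or has in its
  middle, an element below its left neighbour, cutting such an ordering at its minimum gives two
  orderings of the same kind, the first one nonempty. Hence the exponential generating function
  satisfies \<open>D' = D\<^sup>2 - D + 1\<close>, \<open>D(0) = 1\<close>, whose solution is
  \<open>D(z) = 1/2 + (\<surd>3/2) cot(\<pi>/3 - (\<surd>3/2) z)\<close>. By the reflection formula the cotangent is a
  difference of two digamma functions, so its Taylor coefficients are polygamma values, that is,
  the two halves of the bilateral series.
\<close>

subsection \<open>Orderings that avoid 123 after a smaller element\<close>

fun consec_avoids_123 :: "'a::linorder list \<Rightarrow> bool" where
  "consec_avoids_123 (x # y # z # zs) \<longleftrightarrow> \<not> (x < y \<and> y < z) \<and> consec_avoids_123 (y # z # zs)"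
| "consec_avoids_123 _ \<longleftrightarrow> True"

text \<open>Stands in for a smaller element placed in front: with distinct entries, such an element
  starts an occurrence of 123 exactly when the list begins with an ascent.\<close>

fun no_initial_ascent :: "'a::linorder list \<Rightarrow> bool" where
  "no_initial_ascent (x # y # zs) \<longleftrightarrow> y < x"
| "no_initial_ascent _ \<longleftrightarrow> True"

text \<open>Indexed by an arbitrary set, so that both pieces of a cut ordering are instances again,
  without renumbering their entries.\<close>

definition avoiding_orderings :: "'a::linorder set \<Rightarrow> 'a list set" where
  "avoiding_orderings S =
     {xs. distinct xs \<and> set xs = S \<and> consec_avoids_123 xs \<and> no_initial_ascent xs}"

text \<open>A window whose second or third entry is \<open>m\<close> has a descent just before
  \<open>m\<close>, so it is no occurrence. All other windows lie inside \<open>ys\<close> or inside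
  \<open>m # zs\<close>.\<close>

lemma consec_avoids_123_append_min:
  assumes "\<forall>y\<in>set ys. m < y"
  shows "consec_avoids_123 (ys @ m # zs) \<longleftrightarrow> consec_avoids_123 ys \<and> consec_avoids_123 (m # zs)"
  using assms
proof (induction ys rule: consec_avoids_123.induct)
  case ("2_2" y)
  then show ?case by (cases zs) auto
next
  case ("2_3" x y)
  then show ?case by (cases zs) auto
qed auto

lemma consec_avoids_123_Cons_min:
  assumes "\<forall>z\<in>set zs. m < z" "distinct zs"
  shows "consec_avoids_123 (m # zs) \<longleftrightarrow> consec_avoids_123 zs \<and> no_initial_ascent zs"
  using assms by (cases zs rule: no_initial_ascent.cases) auto

lemma no_initial_ascent_append_min:
  assumes "\<forall>y\<in>set ys. m < y" "ys \<noteq> []"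
  shows "no_initial_ascent (ys @ m # zs) \<longleftrightarrow> no_initial_ascent ys"
  using assms by (cases ys rule: no_initial_ascent.cases) auto

lemma finite_avoiding_orderings: "finite S \<Longrightarrow> finite (avoiding_orderings S)"
  by (rule finite_subset[OF _ finite_lists_length_eq[of S "card S"]])
     (auto simp: avoiding_orderings_def dest: distinct_card)

lemma avoiding_orderings_empty [simp]: "avoiding_orderings {} = {[]}"
  by (auto simp: avoiding_orderings_def)

lemma avoiding_orderings_singleton [simp]: "avoiding_orderings {x} = {[x]}"
proof -
  have "xs = [x]" if "distinct xs" "set xs = {x}" for xs
  proof -
    have "length xs = 1" using distinct_card[OF that(1)] that(2) by simp
    then show ?thesis using that(2) by (cases xs) auto
  qed
  then show ?thesis by (auto simp: avoiding_orderings_def)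
qed

text \<open>\<open>T\<close> collects the entries left of the minimum. It is nonempty, since a list
  starting with \<open>m\<close> would have an initial ascent. The piece before \<open>m\<close>
  keeps its initial condition; the piece after \<open>m\<close> has \<open>m\<close> itself as
  smaller predecessor.\<close>

lemma avoiding_orderings_insert_min:
  assumes "finite A" "A \<noteq> {}" "\<forall>a\<in>A. m < a"
  shows "bij_betw (\<lambda>(T, ys, zs). ys @ m # zs)
     (SIGMA T:Pow A - {{}}. avoiding_orderings T \<times> avoiding_orderings (A - T))
     (avoiding_orderings (insert m A))"
  unfolding bij_betw_def
proof
  show "inj_on (\<lambda>(T, ys, zs). ys @ m # zs)
     (SIGMA T:Pow A - {{}}. avoiding_orderings T \<times> avoiding_orderings (A - T))" (is "inj_on ?f ?D")
  proof (rule inj_onI)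
    fix p q assume D: "p \<in> ?D" "q \<in> ?D" and f_eq: "?f p = ?f q"
    obtain T ys zs T' ys' zs' where pq: "p = (T, ys, zs)" "q = (T', ys', zs')"
      by (metis prod_cases3)
    have T: "T \<subseteq> A" "T' \<subseteq> A" "ys \<in> avoiding_orderings T" "ys' \<in> avoiding_orderings T'"
      and Z: "zs \<in> avoiding_orderings (A - T)" "zs' \<in> avoiding_orderings (A - T')"
      and eq: "ys @ m # zs = ys' @ m # zs'"
      using D f_eq by (auto simp: pq)
    have s: "set ys = T" "set ys' = T'" using T by (auto simp: avoiding_orderings_def)
    have s': "set zs = A - T" "set zs' = A - T'" using Z by (auto simp: avoiding_orderings_def)
    have m: "m \<notin> set ys" "m \<notin> set ys'" "m \<notin> set zs" "m \<notin> set zs'"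
      using s s' T assms(3) by auto
    \<comment> \<open>\<open>m\<close> occurs only once on each side, so it fixes the place of the
      cut.\<close>
    from eq m have "ys = ys'" "zs = zs'"
      by (auto simp: append_eq_append_conv2 append_eq_Cons_conv Cons_eq_append_conv)
    with s show "p = q" by (simp add: pq)
  qed
  show "(\<lambda>(T, ys, zs). ys @ m # zs) `
     (SIGMA T:Pow A - {{}}. avoiding_orderings T \<times> avoiding_orderings (A - T)) =
     avoiding_orderings (insert m A)" (is "?f ` ?D = _")
  proof (intro equalityI subsetI)
    fix xs assume "xs \<in> ?f ` ?D"
    then obtain T ys zs where *: "xs = ys @ m # zs" "T \<subseteq> A" "T \<noteq> {}"
      "ys \<in> avoiding_orderings T" "zs \<in> avoiding_orderings (A - T)" by auto
    have s: "set ys = T" "set zs = A - T" "distinct ys" "distinct zs"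
      using * by (auto simp: avoiding_orderings_def)
    have m: "\<forall>y\<in>set ys. m < y" "\<forall>z\<in>set zs. m < z" using s * assms by auto
    have "ys \<noteq> []" using s * by auto
    with * s m show "xs \<in> avoiding_orderings (insert m A)"
      by (auto simp: avoiding_orderings_def consec_avoids_123_append_min
          consec_avoids_123_Cons_min no_initial_ascent_append_min)
  next
    fix xs assume xs: "xs \<in> avoiding_orderings (insert m A)"
    then have "m \<in> set xs" by (auto simp: avoiding_orderings_def)
    then obtain ys zs where split: "xs = ys @ m # zs" by (meson split_list)
    have d: "distinct ys" "distinct zs" "set ys \<inter> set zs = {}" "m \<notin> set ys" "m \<notin> set zs"
      using xs by (auto simp: split avoiding_orderings_def)
    have "m \<notin> A" using assms by auto
    have "set ys \<union> set zs = A"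
      using xs d \<open>m \<notin> A\<close> by (auto simp: split avoiding_orderings_def)
    then have s: "set ys \<subseteq> A" "set zs = A - set ys" using d by auto
    then have m: "\<forall>y\<in>set ys. m < y" "\<forall>z\<in>set zs. m < z" using assms by auto
    have ys: "ys \<noteq> []"
    proof
      assume "ys = []"
      then obtain z zs' where "zs = z # zs'" using s assms by (cases zs) auto
      then show False using xs m by (auto simp: split \<open>ys = []\<close> avoiding_orderings_def)
    qed
    have "ys \<in> avoiding_orderings (set ys)" "zs \<in> avoiding_orderings (A - set ys)"
      using xs d s m ys by (auto simp: split avoiding_orderings_def consec_avoids_123_append_min
          consec_avoids_123_Cons_min no_initial_ascent_append_min)
    then have "(set ys, ys, zs) \<in> ?D" using s ys by auto
    moreover have "xs = ?f (set ys, ys, zs)" by (simp add: split)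
    ultimately show "xs \<in> ?f ` ?D" by (rule rev_image_eqI)
  qed
qed

lemma card_avoiding_orderings_insert_min:
  assumes "finite A" "A \<noteq> {}" "\<forall>a\<in>A. m < a"
  shows "card (avoiding_orderings (insert m A)) =
    (\<Sum>T\<in>Pow A - {{}}. card (avoiding_orderings T) * card (avoiding_orderings (A - T)))"
proof -
  have "finite T" if "T \<subseteq> A" for T using that assms(1) finite_subset by blast
  then show ?thesis
    unfolding bij_betw_same_card[OF avoiding_orderings_insert_min[OF assms], symmetric]
    using assms(1) by (subst card_SigmaI) (auto simp: card_cartesian_product finite_avoiding_orderings)
qed

section \<open>The recurrence for the number of orderings\<close>

lemma sum_Pow_card:
  fixes g :: "nat \<Rightarrow> 'b::comm_semiring_1"
  assumes "finite A"
  shows "(\<Sum>T\<in>Pow A. g (card T)) = (\<Sum>k\<le>card A. of_nat (card A choose k) * g k)"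
proof -
  have "(\<Sum>T\<in>Pow A. g (card T)) = (\<Sum>k\<le>card A. \<Sum>T\<in>{T\<in>Pow A. card T = k}. g (card T))"
    using assms by (intro sum.group[symmetric]) (auto intro: card_mono)
  also have "\<dots> = (\<Sum>k\<le>card A. of_nat (card A choose k) * g k)"
    by (intro sum.cong) (auto simp: n_subsets[OF assms, symmetric])
  finally show ?thesis .
qed

text \<open>The hypotheses are D(0) = 1 and D' = D^2 - D + 1 in coefficient form. The term
  \<open>- e n\<close> discards the empty front piece, and the 1 at \<open>n = 0\<close> restores
  the one-element ordering. The recurrence determines the counts, so any real sequence satisfying it
  will do.\<close>

lemma card_avoiding_orderings:
  fixes e :: "nat \<Rightarrow> real"
  assumes e0: "e 0 = 1"
    and e_Suc: "\<And>n. real (Suc n) * e (Suc n) =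
      (\<Sum>k\<le>n. e k * e (n - k)) - e n + (if n = 0 then 1 else 0)"
    and "finite S"
  shows "real (card (avoiding_orderings S)) = fact (card S) * e (card S)"
  using \<open>finite S\<close>
proof (induction "card S" arbitrary: S rule: less_induct)
  case less
  consider "S = {}" | x where "S = {x}" | m A where "S = insert m A" "A \<noteq> {}" "\<forall>a\<in>A. m < a"
  proof (cases "S = {}")
    case False
    then have "S = insert (Min S) (S - {Min S})" "\<forall>a\<in>S - {Min S}. Min S < a"
      using less.prems by (auto simp: insert_absorb less_le)
    then show ?thesis using that by (metis)
  qed
  then show ?case
  proof cases
    case 1
    then show ?thesis by (simp add: e0)
  next
    case 2
    \<comment> \<open>The recurrence at 0 reads \<open>e 1 = 1 - 1 + 1\<close>.\<close>
    then show ?thesis using e_Suc[of 0] by (simp add: e0)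
  next
    case (3 m A)
    define n where "n = card A"
    have A: "finite A" "m \<notin> A" using 3 less.prems by auto
    then have cS: "card S = Suc n" by (simp add: 3 n_def)
    have n0: "n \<noteq> 0" using 3 A by (simp add: n_def)
    have IH: "real (card (avoiding_orderings T)) = fact (card T) * e (card T)" if "T \<subseteq> A" for T
      using that A card_mono[OF A(1) that] finite_subset[OF that]
      by (intro less.hyps) (auto simp: cS n_def[symmetric])
    have "real (card (avoiding_orderings S)) =
      (\<Sum>T\<in>Pow A - {{}}. real (card (avoiding_orderings T)) * real (card (avoiding_orderings (A - T))))"
      using 3 A by (simp add: card_avoiding_orderings_insert_min)
    also have "\<dots> = (\<Sum>T\<in>Pow A - {{}}. fact (card T) * e (card T) * (fact (n - card T) * e (n - card T)))"
      by (intro sum.cong refl) (auto simp: IH n_def card_Diff_subset finite_subset[OF _ A(1)])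
    \<comment> \<open>The term of \<open>T = {}\<close> is added and subtracted; its front factor is
      1.\<close>
    also have "\<dots> = (\<Sum>T\<in>Pow A. fact (card T) * e (card T) * (fact (n - card T) * e (n - card T)))
        - fact n * e n"
      using A by (subst sum_diff1) (auto simp: e0)
    also have "(\<Sum>T\<in>Pow A. fact (card T) * e (card T) * (fact (n - card T) * e (n - card T))) =
        (\<Sum>k\<le>n. real (n choose k) * (fact k * e k * (fact (n - k) * e (n - k))))"
      unfolding n_def by (rule sum_Pow_card[OF A(1)])
    also have "\<dots> = fact n * (\<Sum>k\<le>n. e k * e (n - k))"
      unfolding sum_distrib_left
      by (intro sum.cong refl) (simp add: binomial_fact)
    also have "\<dots> - fact n * e n = fact (Suc n) * e (Suc n)"
    proof -
      have "(\<Sum>k\<le>n. e k * e (n - k)) = real (Suc n) * e (Suc n) + e n"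
        using e_Suc[of n] n0 by simp
      then show ?thesis by (simp only: fact_Suc) (simp add: algebra_simps)
    qed
    finally show ?thesis by (simp add: cS)
  qed
qed

subsection \<open>Rotating the minimum to the front\<close>

lemma consec_avoids_123_conv_nth:
  "consec_avoids_123 xs \<longleftrightarrow>
     (\<forall>i. i + 2 < length xs \<longrightarrow> \<not> (xs ! i < xs ! (i + 1) \<and> xs ! (i + 1) < xs ! (i + 2)))"
proof (induction xs rule: consec_avoids_123.induct)
  case (1 x y z zs)
  \<comment> \<open>Separates the window at position 0 from those of the tail, which the induction
    hypothesis covers.\<close>
  have split: "(\<forall>i. P i) \<longleftrightarrow> P 0 \<and> (\<forall>i. P (Suc i))" for P :: "nat \<Rightarrow> bool"
    by (metis not0_implies_Suc)
  show ?case
    unfolding consec_avoids_123.simps 1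
    by (subst (2) split) simp
qed auto

definition cyclic_avoids_123 :: "'a::linorder list \<Rightarrow> bool" where
  "cyclic_avoids_123 xs \<longleftrightarrow> (\<forall>i<length xs.
     \<not> (xs ! i < xs ! ((i + 1) mod length xs) \<and>
        xs ! ((i + 1) mod length xs) < xs ! ((i + 2) mod length xs)))"

text \<open>Rotation merely permutes the cyclic windows: the one at \<open>i\<close> is the one of
  \<open>xs\<close> at \<open>p + i\<close> modulo the length.\<close>

lemma cyclic_avoids_123_rotate:
  assumes "cyclic_avoids_123 xs"
  shows "cyclic_avoids_123 (rotate p xs)"
  unfolding cyclic_avoids_123_def
proof (intro allI impI)
  fix i assume i: "i < length (rotate p xs)"
  define n where "n = length xs"
  have n: "n > 0" "i < n" using i by (auto simp: n_def)
  define j where "j = (p + i) mod n"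
  have "j < n" using n by (simp add: j_def)
  then have *: "\<not> (xs ! j < xs ! ((j + 1) mod n) \<and> xs ! ((j + 1) mod n) < xs ! ((j + 2) mod n))"
    using assms by (simp add: cyclic_avoids_123_def n_def)
  have "rotate p xs ! ((i + k) mod n) = xs ! ((j + k) mod n)" for k
    using n by (simp add: nth_rotate n_def[symmetric] j_def mod_simps add_ac)
  from this[of 0] this[of 1] this[of 2] * n \<open>j < n\<close>
  show "\<not> (rotate p xs ! i < rotate p xs ! ((i + 1) mod length (rotate p xs)) \<and>
        rotate p xs ! ((i + 1) mod length (rotate p xs)) <
        rotate p xs ! ((i + 2) mod length (rotate p xs)))"
    by (simp add: n_def[symmetric])
qed

text \<open>The two windows that wrap around have the minimum as third or second entry, so neither
  is an occurrence and only the linear windows matter.\<close>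

lemma cyclic_avoids_123_Cons_min:
  assumes "\<forall>x\<in>set xs. m < x" "distinct xs" "xs \<noteq> []"
  shows "cyclic_avoids_123 (m # xs) \<longleftrightarrow> consec_avoids_123 xs \<and> no_initial_ascent xs"
proof -
  define n where "n = length (m # xs)"
  have n: "n \<ge> 2" using assms by (cases xs) (auto simp: n_def)
  have min: "\<not> (m # xs) ! i < m" if "i < n" for i
    using that assms(1) by (cases i) (auto simp: n_def not_less intro: less_imp_le)
  have "cyclic_avoids_123 (m # xs) \<longleftrightarrow> consec_avoids_123 (m # xs)"
    unfolding consec_avoids_123_conv_nth cyclic_avoids_123_def n_def[symmetric]
  proof (intro iffI allI impI)
    fix i assume *: "\<forall>i<n. \<not> ((m # xs) ! i < (m # xs) ! ((i + 1) mod n) \<and>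
        (m # xs) ! ((i + 1) mod n) < (m # xs) ! ((i + 2) mod n))" and i: "i + 2 < n"
    show "\<not> ((m # xs) ! i < (m # xs) ! (i + 1) \<and> (m # xs) ! (i + 1) < (m # xs) ! (i + 2))"
      using *[rule_format, of i] i by simp
  next
    fix i assume *: "\<forall>i. i + 2 < n \<longrightarrow>
        \<not> ((m # xs) ! i < (m # xs) ! (i + 1) \<and> (m # xs) ! (i + 1) < (m # xs) ! (i + 2))"
      and i: "i < n"
    consider "i + 2 < n" | "i + 2 = n" | "i + 1 = n" using i by linarith
    then show "\<not> ((m # xs) ! i < (m # xs) ! ((i + 1) mod n) \<and>
        (m # xs) ! ((i + 1) mod n) < (m # xs) ! ((i + 2) mod n))"
    proof cases
      case 1
      then show ?thesis using * by simp
    next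
      case 2
      then show ?thesis using min[of "i + 1"] by simp
    next
      case 3
      then show ?thesis using min[OF i] by simp
    qed
  qed
  then show ?thesis using consec_avoids_123_Cons_min assms by blast
qed

text \<open>The minimum marks a unique starting point on the circle. The range
  \<open>{..card A}\<close> holds one rotation per residue modulo the length, which yields the
  factor \<open>n\<close> in the count.\<close>

lemma bij_betw_rotate_min_first:
  assumes "finite A" "A \<noteq> {}" "\<forall>a\<in>A. m < a"
  shows "bij_betw (\<lambda>(p, xs). rotate p (m # xs)) ({..card A} \<times> avoiding_orderings A)
     {xs. distinct xs \<and> set xs = insert m A \<and> cyclic_avoids_123 xs}"
  unfolding bij_betw_def
proof
  define n where "n = Suc (card A)"
  have mA: "m \<notin> A" using assms by auto
  have props: "distinct (m # xs)" "set xs = A" "length (m # xs) = n" "cyclic_avoids_123 (m # xs)"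
    if "xs \<in> avoiding_orderings A" for xs
  proof -
    show *: "distinct (m # xs)" "set xs = A" "length (m # xs) = n"
      using that mA by (auto simp: avoiding_orderings_def n_def distinct_card)
    show "cyclic_avoids_123 (m # xs)"
      using * that assms by (subst cyclic_avoids_123_Cons_min) (auto simp: avoiding_orderings_def)
  qed
  show "inj_on (\<lambda>(p, xs). rotate p (m # xs)) ({..card A} \<times> avoiding_orderings A)"
  proof (rule inj_onI, clarify)
    fix p q xs ys
    assume pq: "p \<le> card A" "q \<le> card A"
      and xs: "xs \<in> avoiding_orderings A" and ys: "ys \<in> avoiding_orderings A"
      and eq: "rotate p (m # xs) = rotate q (m # ys)"
    \<comment> \<open>The net rotation from \<open>m # ys\<close> to \<open>m # xs\<close>; it must
      fix the position of \<open>m\<close>, hence vanish.\<close>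
    define r where "r = (n - p + q) mod n"
    have pn: "p < n" "q < n" using pq by (auto simp: n_def)
    have "m # xs = rotate (n - p) (rotate p (m # xs))"
      using props(3)[OF xs] pn by (simp add: rotate_rotate)
    also have "\<dots> = rotate r (m # ys)"
      unfolding eq rotate_rotate r_def using props(3)[OF ys] rotate_conv_mod by metis
    finally have r: "m # xs = rotate r (m # ys)" .
    have "r < n" by (simp add: r_def n_def)
    then have "(m # ys) ! r = m"
      using arg_cong[OF r, of "\<lambda>xs. xs ! 0"] props(3)[OF ys] by (simp add: nth_rotate)
    then have "r = 0"
      using props(1)[OF ys] props(3)[OF ys] \<open>r < n\<close>
      by (metis nth_Cons_0 nth_eq_iff_index_eq n_def zero_less_Suc)
    moreover have "p = q"
    proof (cases "p \<le> q")
      case True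
      then have "n - p + q = (q - p) + n" using pn by simp
      then have "r = q - p" unfolding r_def using pn by (simp only: mod_add_self2) simp
      then show ?thesis using \<open>r = 0\<close> True by simp
    next
      \<comment> \<open>Here \<open>n - p + q\<close> lies strictly between 0 and \<open>n\<close>,
        contradicting \<open>r = 0\<close>.\<close>
      case False
      then show ?thesis using \<open>r = 0\<close> pn by (simp add: r_def)
    qed
    ultimately show "p = q \<and> xs = ys" using r by simp
  qed
  show "(\<lambda>(p, xs). rotate p (m # xs)) ` ({..card A} \<times> avoiding_orderings A) =
     {xs. distinct xs \<and> set xs = insert m A \<and> cyclic_avoids_123 xs}" (is "?f ` ?D = ?R")
  proof (intro equalityI subsetI)
    fix xs assume "xs \<in> ?f ` ?D"
    then show "xs \<in> ?R" using props cyclic_avoids_123_rotate by fastforce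
  next
    fix xs assume "xs \<in> ?R"
    then have xs: "distinct xs" "set xs = insert m A" "cyclic_avoids_123 xs" by auto
    have len: "length xs = n"
      using distinct_card[OF xs(1)] xs(2) mA assms by (simp add: n_def)
    obtain i where i: "i < n" "xs ! i = m" using xs(2) len by (metis in_set_conv_nth insertI1)
    define u where "u = rotate i xs"
    have "u \<noteq> []" using len by (auto simp: u_def n_def)
    have "hd u = m" using i len hd_rotate_conv_nth[of xs i] \<open>u \<noteq> []\<close> by (simp add: u_def)
    then obtain ys where ys: "u = m # ys" using \<open>u \<noteq> []\<close> by (cases u) auto
    have "distinct u" "set u = insert m A" "cyclic_avoids_123 u"
      using xs by (auto simp: u_def cyclic_avoids_123_rotate)
    then have d: "distinct ys" "set ys = A" "cyclic_avoids_123 (m # ys)" using mA by (auto simp: ys)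
    moreover have "ys \<noteq> []" using d assms by auto
    ultimately have "ys \<in> avoiding_orderings A"
      using assms by (auto simp: avoiding_orderings_def cyclic_avoids_123_Cons_min)
    \<comment> \<open>The reduction matters for \<open>i = 0\<close>, where \<open>n - i\<close>
      falls outside \<open>{..card A}\<close>.\<close>
    moreover have "rotate ((n - i) mod n) (m # ys) = xs"
    proof -
      have "rotate ((n - i) mod n) u = rotate (n - i) u"
        by (metis len u_def length_rotate rotate_conv_mod)
      also have "\<dots> = xs" using len i by (simp add: u_def rotate_rotate)
      finally show ?thesis by (simp add: ys)
    qed
    moreover have "(n - i) mod n \<le> card A"
      using n_def mod_less_divisor[of n] less_Suc_eq_le by auto
    ultimately show "xs \<in> ?f ` ?D" by (force intro!: image_eqI[of _ _ "((n - i) mod n, ys)"])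
  qed
qed

section \<open>From permutations to lists\<close>

lemma bij_betw_permutes_lists:
  "bij_betw (\<lambda>\<pi>. map \<pi> [1..<Suc n]) {\<pi>. \<pi> permutes {1..n}} {xs. distinct xs \<and> set xs = {1..n}}"
  unfolding bij_betw_def
proof
  show "inj_on (\<lambda>\<pi>. map \<pi> [1..<Suc n]) {\<pi>. \<pi> permutes {1..n}}"
  proof (rule inj_onI, clarify)
    fix f g assume f: "f permutes {1..n}" and g: "g permutes {1..n}"
      and "map f [1..<Suc n] = map g [1..<Suc n]"
    then have "f i = g i" if "i \<in> {1..n}" for i
      using that by (simp del: upt_Suc)
    then show "f = g" using permutes_not_in[OF f] permutes_not_in[OF g] by (metis ext)
  qed
  show "(\<lambda>\<pi>. map \<pi> [1..<Suc n]) ` {\<pi>. \<pi> permutes {1..n}} = {xs. distinct xs \<and> set xs = {1..n}}"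
  proof (intro equalityI subsetI)
    fix xs assume "xs \<in> (\<lambda>\<pi>. map \<pi> [1..<Suc n]) ` {\<pi>. \<pi> permutes {1..n}}"
    then obtain \<pi> where \<pi>: "\<pi> permutes {1..n}" and xs: "xs = map \<pi> [1..<Suc n]" by auto
    have "set [1..<Suc n] = {1..n}" by auto
    then show "xs \<in> {xs. distinct xs \<and> set xs = {1..n}}"
      using permutes_image[OF \<pi>] permutes_inj_on[OF \<pi>] by (simp add: xs distinct_map del: upt_Suc)
  next
    fix xs assume "xs \<in> {xs. distinct xs \<and> set xs = {1..n}}"
    then have xs: "distinct xs" "set xs = {1..n}" by auto
    have len: "length xs = n" using distinct_card[OF xs(1)] xs(2) by simp
    \<comment> \<open>The inverse map: list indices start at 0, and \<open>permutes\<close> demands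
      the identity outside \<open>{1..n}\<close>.\<close>
    define \<pi> where "\<pi> i = (if i \<in> {1..n} then xs ! (i - 1) else i)" for i
    have eq: "map \<pi> [1..<Suc n] = xs"
      by (rule nth_equalityI) (auto simp: len \<pi>_def simp del: upt_Suc)
    have "set [1..<Suc n] = {1..n}" by auto
    then have "bij_betw \<pi> {1..n} {1..n}"
      using xs unfolding eq[symmetric] bij_betw_def by (simp add: distinct_map del: upt_Suc)
    then have "\<pi> permutes {1..n}" by (rule bij_imp_permutes) (auto simp: \<pi>_def)
    then show "xs \<in> (\<lambda>\<pi>. map \<pi> [1..<Suc n]) ` {\<pi>. \<pi> permutes {1..n}}" using eq by blast
  qed
qed

text \<open>The position \<open>cyc_pos n (i + 1)\<close> is list index \<open>i mod n\<close>, so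
  both conditions range over the same windows, shifted by one.\<close>

lemma cyc_consec_avoids_123_conv_list:
  assumes "n > 0"
  shows "cyc_consec_avoids_123 n \<pi> \<longleftrightarrow> cyclic_avoids_123 (map \<pi> [1..<Suc n])"
proof -
  have nth: "map \<pi> [1..<Suc n] ! (i mod n) = \<pi> (cyc_pos n (i + 1))" for i
    using assms by (simp add: cyc_pos_def del: upt_Suc)
  have "cyclic_avoids_123 (map \<pi> [1..<Suc n]) \<longleftrightarrow> (\<forall>i<n.
      \<not> (\<pi> (cyc_pos n (i + 1)) < \<pi> (cyc_pos n (i + 1 + 1)) \<and>
         \<pi> (cyc_pos n (i + 1 + 1)) < \<pi> (cyc_pos n (i + 2 + 1))))"
    unfolding cyclic_avoids_123_def nth[symmetric] by (simp del: upt_Suc)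
  also have "\<dots> \<longleftrightarrow> (\<forall>j\<in>{1..n}. 
      \<not> (\<pi> (cyc_pos n j) < \<pi> (cyc_pos n (j + 1)) \<and> \<pi> (cyc_pos n (j + 1)) < \<pi> (cyc_pos n (j + 2))))"
    unfolding image_Suc_lessThan[symmetric] by auto
  finally show ?thesis by (auto simp: cyc_consec_avoids_123_def)
qed

lemma beta_123_conv_avoiding_orderings:
  assumes "n \<ge> 2"
  shows "beta_123 n = n * card (avoiding_orderings {2..n})"
proof -
  have "bij_betw (\<lambda>\<pi>. map \<pi> [1..<Suc n]) {\<pi> \<in> {\<pi>. \<pi> permutes {1..n}}. cyc_consec_avoids_123 n \<pi>}
      {xs \<in> {xs. distinct xs \<and> set xs = {1..n}}. cyclic_avoids_123 xs}"
    by (rule bij_betw_Collect[OF bij_betw_permutes_lists])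
       (use assms cyc_consec_avoids_123_conv_list[of n] in \<open>simp del: upt_Suc\<close>)
  then have "beta_123 n = card {xs. distinct xs \<and> set xs = {1..n} \<and> cyclic_avoids_123 xs}"
    unfolding beta_123_def by (auto dest: bij_betw_same_card simp: conj_assoc simp del: upt_Suc)
  also have "{1..n} = insert 1 {2..n}" using assms by auto
  also have "card {xs. distinct xs \<and> set xs = insert 1 {2..n} \<and> cyclic_avoids_123 xs} =
      card ({..card {2..n}} \<times> avoiding_orderings {2..n})"
    using assms by (intro bij_betw_same_card[OF bij_betw_rotate_min_first, symmetric]) auto
  finally show ?thesis using assms by (simp add: card_cartesian_product)
qed

subsection \<open>Taylor coefficients of the cotangent\<close>

text \<open>Logarithmic derivative of the reflection formula: \<open>P\<close> is differentiated
  once as a product of Gamma values and once as pi over a sine.\<close>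

lemma Digamma_reflection:
  fixes z :: complex
  assumes "z \<notin> \<int>"
  shows "Digamma (1 - z) - Digamma z = of_real pi * cot (of_real pi * z)"
proof -
  have "1 - (1 - z) \<notin> \<int>" using assms by simp
  then have "1 - z \<notin> \<int>" using Ints_1 Ints_diff by metis
  with assms have z: "z \<notin> \<int>\<^sub>\<le>\<^sub>0" "1 - z \<notin> \<int>\<^sub>\<le>\<^sub>0"
    by (auto dest: nonpos_Ints_Int)
  have s: "sin (of_real pi * z) \<noteq> 0"
    using assms by (auto simp: sin_eq_0 mult.commute)
  define P where "P = (\<lambda>z::complex. Gamma z * Gamma (1 - z))"
  have "P z \<noteq> 0" using z by (simp add: P_def Gamma_eq_zero_iff)
  have 1: "(P has_field_derivative P z * (Digamma z - Digamma (1 - z))) (at z)"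
    unfolding P_def using z by (auto intro!: derivative_eq_intros simp: algebra_simps)
  have P: "P = (\<lambda>z. of_real pi / sin (of_real pi * z))"
    unfolding P_def by (rule ext, rule Gamma_reflection_complex)
  have 2: "(P has_field_derivative - (P z * (of_real pi * cot (of_real pi * z)))) (at z)"
    unfolding P using DERIV_divide[OF DERIV_const DERIV_chain2[OF DERIV_sin DERIV_cmult_Id] s]
    by (rule DERIV_cong) (simp add: cot_def)
  have "P z * (Digamma z - Digamma (1 - z)) = P z * (- (of_real pi * cot (of_real pi * z)))"
    using DERIV_unique[OF 1 2] by simp
  then have "Digamma z - Digamma (1 - z) = - (of_real pi * cot (of_real pi * z))"
    using \<open>P z \<noteq> 0\<close> mult_left_cancel by blast
  then show ?thesis by (simp add: algebra_simps)
qed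

text \<open>Reads iterated derivatives off an explicit tower. Openness of \<open>U\<close> makes the
  induction hypothesis hold near \<open>z\<close>, as differentiating it requires.\<close>

lemma higher_deriv_eqI:
  fixes g :: "nat \<Rightarrow> 'a::real_normed_field \<Rightarrow> 'a"
  assumes "open U" "z \<in> U"
    and "\<And>n z. z \<in> U \<Longrightarrow> (g n has_field_derivative g (Suc n) z) (at z)"
  shows "(deriv ^^ n) (g 0) z = g n z"
  using \<open>z \<in> U\<close>
proof (induction n arbitrary: z)
  case (Suc n)
  have "eventually (\<lambda>w. w \<in> U) (nhds z)"
    using Suc.prems assms(1) by (rule eventually_nhds_in_open[rotated])
  then have "eventually (\<lambda>w. (deriv ^^ n) (g 0) w = g n w) (nhds z)"
    by eventually_elim (rule Suc.IH)
  then have "deriv ((deriv ^^ n) (g 0)) z = deriv (g n) z"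
    by (intro deriv_cong_ev) auto
  also have "\<dots> = g (Suc n) z" by (rule DERIV_imp_deriv[OF assms(3)[OF Suc.prems]])
  finally show ?case by simp
qed simp

text \<open>
  The Taylor coefficients at \<open>0\<close> of \<open>1/2 + c (\<psi>(2/3 + c z) - \<psi>(1/3 - c z))\<close> with
  \<open>c = \<surd>3 / (2 \<pi>)\<close>, which equals \<open>D(z)\<close> by reflection.
\<close>

definition cot_coeff :: "nat \<Rightarrow> real" where
  "cot_coeff n = (let c = sqrt 3 / (2 * pi) in
     (if n = 0 then 1 / 2 else 0) +
     c * (c ^ n * Polygamma n (2 / 3) - (- c) ^ n * Polygamma n (1 / 3)) / fact n)"

text \<open>One holomorphic function is described twice: its polygamma form gives the Taylor
  coefficients, its cotangent form the differential equation. Uniqueness of expansions turns the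
  equation into the recurrence.\<close>

lemma cot_coeff_rec:
  shows "cot_coeff 0 = 1"
    and "real (Suc n) * cot_coeff (Suc n) =
      (\<Sum>k\<le>n. cot_coeff k * cot_coeff (n - k)) - cot_coeff n + (if n = 0 then 1 else 0)"
proof -
  define c :: complex where "c = of_real (sqrt 3 / (2 * pi))"
  \<comment> \<open>On this strip \<open>1 / 3 - c * z\<close> and its reflection
    \<open>2 / 3 + c * z\<close> have positive real part, so the polygamma poles are avoided, and
    the former is no integer.\<close>
  define U where "U = {z. 0 < Re (1 / 3 - c * z) \<and> Re (1 / 3 - c * z) < 1}"
  have U: "open U" "0 \<in> U"
    unfolding U_def by (auto intro!: open_Collect_conj open_Collect_less continuous_intros)
  \<comment> \<open>The tower of derivatives of \<open>g 0\<close>, in which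
    \<open>Polygamma 0\<close> is \<open>Digamma\<close>.\<close>
  define g where "g n z = (if n = 0 then 1 / 2 else 0) +
      c * (c ^ n * Polygamma n (2 / 3 + c * z) - (- c) ^ n * Polygamma n (1 / 3 - c * z))"
    for n z
  have nonpos: "w \<notin> \<int>\<^sub>\<le>\<^sub>0" if "0 < Re w" for w :: complex
    using that by (auto elim!: nonpos_Ints_cases)
  have not_Int: "w \<notin> \<int>" if "0 < Re w" "Re w < 1" for w :: complex
    using that by (auto elim!: Ints_cases)
  have args: "0 < Re (1 / 3 - c * z)" "0 < Re (2 / 3 + c * z)" "1 / 3 - c * z \<notin> \<int>" if "z \<in> U" for z
    using that not_Int[of "1 / 3 - c * z"] by (auto simp: U_def)
  have g_deriv: "(g n has_field_derivative g (Suc n) z) (at z)" if "z \<in> U" for n z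
    unfolding g_def using nonpos args[OF that]
    by (auto intro!: derivative_eq_intros simp: algebra_simps)
  define F where "F = fps_expansion (g 0) 0"
  have "g 0 holomorphic_on U"
    using g_deriv U(1) by (auto simp: holomorphic_on_open)
  then have F: "g 0 has_fps_expansion F"
    unfolding F_def using U by (intro has_fps_expansion_fps_expansion)
  have nth: "fps_nth F n = of_real (cot_coeff n)" for n
  proof -
    have eq: "Polygamma n (1 / 3 :: complex) = of_real (Polygamma n (1 / 3))"
      "Polygamma n (2 / 3 :: complex) = of_real (Polygamma n (2 / 3))"
      using Polygamma_of_real[of "1 / 3" n, where 'a = complex]
        Polygamma_of_real[of "2 / 3" n, where 'a = complex] by simp_all
    have "fps_nth F n = g n 0 / fact n"
      unfolding fps_nth_fps_expansion[OF F] using higher_deriv_eqI[where g = g, OF U g_deriv] by simp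
    also have "\<dots> = of_real (cot_coeff n)"
      by (simp add: g_def cot_coeff_def Let_def c_def eq add_divide_distrib)
    finally show ?thesis .
  qed
  have c_pi: "c * of_real pi = of_real (sqrt 3 / 2)" by (simp add: c_def)
  have g0: "g 0 z = 1 / 2 + of_real (sqrt 3 / 2) * cot (of_real pi * (1 / 3 - c * z))" if "z \<in> U" for z
  proof -
    have "g 0 z = 1 / 2 + c * (Digamma (1 - (1 / 3 - c * z)) - Digamma (1 / 3 - c * z))"
      by (simp add: g_def algebra_simps)
    also have "\<dots> = 1 / 2 + (c * of_real pi) * cot (of_real pi * (1 / 3 - c * z))"
      by (simp only: Digamma_reflection[OF args(3)[OF that]] mult.assoc)
    finally show ?thesis unfolding c_pi .
  qed
  have ode: "deriv (g 0) z = g 0 z * g 0 z - g 0 z + 1" if z: "z \<in> U" for z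
  proof -
    let ?w = "of_real pi * (1 / 3 - c * z)"
    have s: "sin ?w \<noteq> 0" using args(3)[OF z] by (auto simp: sin_eq_0 mult.commute)
    have sq: "complex_of_real (sqrt 3) * complex_of_real (sqrt 3) = 3"
      by (metis of_real_mult real_sqrt_mult_self abs_numeral of_real_numeral)
    have ev: "eventually (\<lambda>w. g 0 w = 1 / 2 + of_real (sqrt 3 / 2) * cot (of_real pi * (1 / 3 - c * w))) (nhds z)"
      using eventually_nhds_in_open[OF U(1) z] by eventually_elim (rule g0)
    have D: "((\<lambda>w. 1 / 2 + of_real (sqrt 3 / 2) * cot (of_real pi * (1 / 3 - c * w)))
        has_field_derivative of_real (sqrt 3 / 2) * (inverse ((sin ?w)\<^sup>2) * (c * of_real pi))) (at z)"
      using s by (auto intro!: derivative_eq_intros DERIV_chain2[OF DERIV_cot])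
    have "deriv (g 0) z = of_real (sqrt 3 / 2) * (inverse ((sin ?w)\<^sup>2) * (c * of_real pi))"
      using deriv_cong_ev[OF ev refl] DERIV_imp_deriv[OF D] by simp
    also have "\<dots> = 3 / 4 * inverse ((sin ?w)\<^sup>2)"
      unfolding c_pi using sq by (simp add: field_simps)
    also have "inverse ((sin ?w)\<^sup>2) = 1 + (cot ?w)\<^sup>2"
      using s sin_cos_squared_add[of ?w] by (simp add: cot_def field_simps)
    \<comment> \<open>Completing the square: D^2 - D + 1 = (D - 1/2)^2 + 3/4.\<close>
    also have "3 / 4 * (1 + (cot ?w)\<^sup>2) = g 0 z * g 0 z - g 0 z + 1"
      unfolding g0[OF z] using sq by (simp add: algebra_simps power2_eq_square)
    finally show ?thesis .
  qed
  have "deriv (g 0) has_fps_expansion fps_deriv F"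
    using F by (rule has_fps_expansion_deriv)
  moreover have "(\<lambda>z. g 0 z * g 0 z - g 0 z + 1) has_fps_expansion F * F - F + 1"
    by (intro fps_expansion_intros F)
  moreover have "eventually (\<lambda>z. deriv (g 0) z = g 0 z * g 0 z - g 0 z + 1) (nhds 0)"
    using eventually_nhds_in_open[OF U] by eventually_elim (rule ode)
  ultimately have "fps_deriv F = F * F - F + 1"
    using fps_expansion_unique_complex has_fps_expansion_cong by metis
  from arg_cong[OF this, of "\<lambda>F. fps_nth F n"]
  have "complex_of_real (real (Suc n) * cot_coeff (Suc n)) =
      of_real ((\<Sum>k\<le>n. cot_coeff k * cot_coeff (n - k)) - cot_coeff n + (if n = 0 then 1 else 0))"
    by (simp add: nth fps_mult_nth atLeast0AtMost algebra_simps)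
  then show "real (Suc n) * cot_coeff (Suc n) =
      (\<Sum>k\<le>n. cot_coeff k * cot_coeff (n - k)) - cot_coeff n + (if n = 0 then 1 else 0)"
    unfolding of_real_eq_iff .
  have "complex_of_real (cot_coeff 0) = g 0 0"
    using nth[of 0] has_fps_expansion_imp_0_eq_fps_nth_0[OF F] by simp
  also have "\<dots> = 1 / 2 + of_real (sqrt 3 / 2) * of_real (cot (pi / 3))"
    by (simp add: g0[OF U(2)] cot_of_real)
  also have "\<dots> = of_real 1"
    unfolding of_real_mult[symmetric] by (simp add: cot_def cos_60 sin_60)
  finally show "cot_coeff 0 = 1" unfolding of_real_eq_iff .
qed

text \<open>The indices \<open>k \<ge> 0\<close> give the series of
  \<open>Polygamma n (1 / 3)\<close>. The negative ones, written \<open>- 1 - k\<close>, have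
  denominators \<open>- (2 / 3 + k)\<close> and give that of \<open>Polygamma n (2 / 3)\<close>. For
  \<open>n > 0\<close> the exponent is at least 2 and the constant 1/2 is absent.\<close>

lemma cot_coeff_has_sum:
  assumes "n > 0"
  shows "((\<lambda>k::int. (sqrt 3 / (2 * pi * (real_of_int k + 1 / 3))) ^ Suc n) has_sum cot_coeff n) UNIV"
proof -
  define c where "c = sqrt 3 / (2 * pi)"
  define f where "f k = (sqrt 3 / (2 * pi * (real_of_int k + 1 / 3))) ^ Suc n" for k :: int
  \<comment> \<open>Nonnegative terms make the ordinary convergent series summable in any
    order.\<close>
  have series: "((\<lambda>k. inverse ((x + real k) ^ Suc n)) has_sum ((-1) ^ Suc n * Polygamma n x / fact n)) UNIV"
    if "x > 0" for x
    using that assms by (intro sums_nonneg_imp_has_sum Polygamma_LIMSEQ) auto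
  have "(f has_sum c ^ Suc n * ((-1) ^ Suc n * Polygamma n (1 / 3) / fact n)) (range int)"
  proof (subst has_sum_reindex)
    have "c ^ Suc n * inverse ((1 / 3 + real k) ^ Suc n) = (f \<circ> int) k" for k
    proof -
      have "sqrt 3 / (2 * pi * (real_of_int (int k) + 1 / 3)) = c * inverse (1 / 3 + real k)"
        by (simp add: c_def divide_simps)
      then show ?thesis by (simp only: f_def o_def power_mult_distrib power_inverse)
    qed
    then show "((f \<circ> int) has_sum c ^ Suc n * ((-1) ^ Suc n * Polygamma n (1 / 3) / fact n)) UNIV"
      using has_sum_cmult_right[OF series[of "1 / 3"], of "c ^ Suc n"] by (simp add: o_def)
  qed auto
  moreover have "(f has_sum (- c) ^ Suc n * ((-1) ^ Suc n * Polygamma n (2 / 3) / fact n))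
      (range (\<lambda>k. - 1 - int k))"
  proof (subst has_sum_reindex)
    have "(- c) ^ Suc n * inverse ((2 / 3 + real k) ^ Suc n) = (f \<circ> (\<lambda>k. - 1 - int k)) k" for k
    proof -
      have "sqrt 3 / (2 * pi * (real_of_int (- 1 - int k) + 1 / 3)) = - c * inverse (2 / 3 + real k)"
      proof -
        have eq: "real_of_int (- 1 - int k) + 1 / 3 = - (2 / 3 + real k)" by simp
        have "s / (t * - x) = - (s / t) * inverse x" for s t x :: real
          by (simp add: divide_inverse)
        then show ?thesis unfolding eq c_def .
      qed
      then show ?thesis by (simp only: f_def o_def power_mult_distrib power_inverse)
    qed
    then show "((f \<circ> (\<lambda>k. - 1 - int k)) has_sum
        (- c) ^ Suc n * ((-1) ^ Suc n * Polygamma n (2 / 3) / fact n)) UNIV"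
      using has_sum_cmult_right[OF series[of "2 / 3"], of "(- c) ^ Suc n"] by (simp add: o_def)
  qed (auto simp: inj_on_def)
  moreover have "range int \<inter> range (\<lambda>k. - 1 - int k) = {}" by auto
  moreover have "range int \<union> range (\<lambda>k. - 1 - int k) = UNIV"
  proof -
    have "k \<in> range int \<union> range (\<lambda>k. - 1 - int k)" for k
    proof (cases "k \<ge> 0")
      case True
      then show ?thesis by (metis UnI1 nonneg_int_cases rangeI)
    next
      case False
      then have "k = - 1 - int (nat (- 1 - k))" by simp
      then show ?thesis by blast
    qed
    then show ?thesis by auto
  qed
  ultimately have "(f has_sum c ^ Suc n * ((-1) ^ Suc n * Polygamma n (1 / 3) / fact n) +
      (- c) ^ Suc n * ((-1) ^ Suc n * Polygamma n (2 / 3) / fact n)) UNIV"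
    using has_sum_Un_disjoint by metis
  moreover have "c ^ Suc n * ((-1) ^ Suc n * Polygamma n (1 / 3) / fact n) +
      (- c) ^ Suc n * ((-1) ^ Suc n * Polygamma n (2 / 3) / fact n) = cot_coeff n"
  proof -
    \<comment> \<open>The sign power is absorbed into the base, exchanging \<open>c\<close> and
      \<open>- c\<close> as in \<open>cot_coeff\<close>.\<close>
    have "a ^ Suc n * ((-1) ^ Suc n * x / y) = (- a) * (- a) ^ n * x / y" for a x y :: real
    proof -
      have "a ^ Suc n * ((-1) ^ Suc n * x / y) = (a * - 1) ^ Suc n * x / y"
        by (simp only: power_mult_distrib mult.assoc times_divide_eq_right)
      then show ?thesis by simp
    qed
    from this[of c] this[of "- c"]
    have "c ^ Suc n * ((-1) ^ Suc n * x / y) = - c * (- c) ^ n * x / y"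
      "(- c) ^ Suc n * ((-1) ^ Suc n * x / y) = c * c ^ n * x / y" for x y :: real
      by (simp_all only: minus_minus)
    moreover have "cot_coeff n =
        c * (c ^ n * Polygamma n (2 / 3) - (- c) ^ n * Polygamma n (1 / 3)) / fact n"
      using assms by (simp add: cot_coeff_def Let_def c_def)
    ultimately show ?thesis
      by (simp only:) (simp add: right_diff_distrib diff_divide_distrib mult.assoc)
  qed
  ultimately show ?thesis unfolding f_def by simp
qed

text \<open>Summability is asserted too, because the infinite sum of a non-summable family is 0 by
  convention.\<close>

theorem theorem3p3:
  fixes n :: nat
  assumes "n \<ge> 2"
  shows "(\<lambda>k::int. (sqrt 3 / (2 * pi * (real_of_int k + 1 / 3))) ^ n) summable_on UNIV \<and>
    real (beta_123 n) =
      fact n * (\<Sum>\<^sub>\<infinity>k::int. (sqrt 3 / (2 * pi * (real_of_int k + 1 / 3))) ^ n)"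
proof -
  \<comment> \<open>The coefficient index is \<open>n - 1\<close>, the number of entries other than
    the value 1.\<close>
  obtain m where n: "n = Suc m" and m: "m > 0" using assms by (cases n) auto
  have sum: "((\<lambda>k::int. (sqrt 3 / (2 * pi * (real_of_int k + 1 / 3))) ^ n) has_sum cot_coeff m) UNIV"
    unfolding n by (rule cot_coeff_has_sum[OF m])
  have "real (beta_123 n) = real n * (fact m * cot_coeff m)"
    using card_avoiding_orderings[OF cot_coeff_rec, of "{2..n}"] assms
    by (simp add: beta_123_conv_avoiding_orderings n distrib_right)
  also have "\<dots> = fact n * cot_coeff m" by (simp add: n algebra_simps)
  finally show ?thesis using infsumI[OF sum] has_sum_imp_summable[OF sum] by simp
qed

end
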